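(* Let $G$ be a nilpotent group of class $2$ equipped with a multiplicative Lie algebra structure $\star$ such that the induced multiplicative Lie algebra structure on $\frac{G}{[G,G]}$ is trivial. Then $\star$ is determined by a map $h:\frac{G}{[G,G]}\times\frac{G}{[G,G]}\to[G,G]$ which satisfies the following conditions for all $x,y,z\in\frac{G}{[G,G]}$: (1) $h(x,x)=1$; (2) $h(xy,z)=h(x,z)h(y,z)$; (3) $h(x,yz)=h(x,y)h(x,z)$.
   Context: Notation: ${}^xy=xyx^{-1}$ and $[x,y]=xyx^{-1}y^{-1}$. A multiplicative Lie algebra is a triple $(G,\cdot,\star)$ where $(G,\cdot)$ is a group and $\star$ is a binary operation on $G$ (called a multiplicative Lie algebra structure on $G$) such that for all $x,y,z\in G$: (i) $x\star x=1$; (ii) $x\star(yz)=(x\star y)\,{}^y(x\star z)$; (iii) $(xy)\star z={}^x(y\star z)\,(x\star z)$; (iv) $((x\star y)\star{}^yz)((y\star z)\star{}^zx)((z\star x)\star{}^xy)=1$; (v) ${}^z(x\star y)=({}^zx)\star({}^zy)$. A group $G$ is nilpotent of class $2$ if $[G,G]\subseteq Z(G)$, where $Z(G)$ is the center and $[G,G]$ the commutator subgroup. The induced structure on $\frac{G}{[G,G]}$ is $a[G,G]\star b[G,G]=(a\star b)[G,G]$; it is trivial if all these products are the identity, i.e. $a\star b\in[G,G]$ for all $a,b\in G$. *)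

theory Defs
  imports "HOL-Algebra.Algebra"
begin

definition conjugate :: "('a, 'm) monoid_scheme \<Rightarrow> 'a \<Rightarrow> 'a \<Rightarrow> 'a" where
  "conjugate G x y = x \<otimes>\<^bsub>G\<^esub> y \<otimes>\<^bsub>G\<^esub> inv\<^bsub>G\<^esub> x"

locale multiplicative_lie_algebra = group G for G (structure) +
  fixes lie :: "'a \<Rightarrow> 'a \<Rightarrow> 'a" (infixl "\<star>" 75)
  assumes lie_closed: "\<lbrakk>x \<in> carrier G; y \<in> carrier G\<rbrakk> \<Longrightarrow> x \<star> y \<in> carrier G"
    and lie_self: "x \<in> carrier G \<Longrightarrow> x \<star> x = \<one>"
    and lie_mult_right: "\<lbrakk>x \<in> carrier G; y \<in> carrier G; z \<in> carrier G\<rbrakk> \<Longrightarrow>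
      x \<star> (y \<otimes> z) = (x \<star> y) \<otimes> conjugate G y (x \<star> z)"
    and lie_mult_left: "\<lbrakk>x \<in> carrier G; y \<in> carrier G; z \<in> carrier G\<rbrakk> \<Longrightarrow>
      (x \<otimes> y) \<star> z = conjugate G x (y \<star> z) \<otimes> (x \<star> z)"
    and lie_jacobi: "\<lbrakk>x \<in> carrier G; y \<in> carrier G; z \<in> carrier G\<rbrakk> \<Longrightarrow>
      ((x \<star> y) \<star> conjugate G y z) \<otimes> ((y \<star> z) \<star> conjugate G z x)
        \<otimes> ((z \<star> x) \<star> conjugate G x y) = \<one>"
    and lie_conjugate: "\<lbrakk>x \<in> carrier G; y \<in> carrier G; z \<in> carrier G\<rbrakk> \<Longrightarrow>
      conjugate G z (x \<star> y) = conjugate G z x \<star> conjugate G z y"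

definition group_center :: "('a, 'm) monoid_scheme \<Rightarrow> 'a set" where
  "group_center G = {z \<in> carrier G. \<forall>g \<in> carrier G. z \<otimes>\<^bsub>G\<^esub> g = g \<otimes>\<^bsub>G\<^esub> z}"

abbreviation commutator_subgroup :: "('a, 'm) monoid_scheme \<Rightarrow> 'a set" where
  "commutator_subgroup G \<equiv> derived G (carrier G)"

text \<open>As in the source convention, abelian groups are included.\<close>

definition nilpotent_class_two :: "('a, 'm) monoid_scheme \<Rightarrow> bool" where
  "nilpotent_class_two G \<longleftrightarrow> group G \<and> commutator_subgroup G \<subseteq> group_center G"

abbreviation abelianization :: "('a, 'm) monoid_scheme \<Rightarrow> 'a set monoid" where
  "abelianization G \<equiv> G Mod commutator_subgroup G"

text \<open>
  The union over all representatives avoids choosing any; by \<open>induced_lie_coset\<close> below all of them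
  give the same coset. Elements of the quotient are right cosets in the library, which agree with
  left cosets since the commutator subgroup is normal.
\<close>

definition induced_lie ::
    "('a, 'm) monoid_scheme \<Rightarrow> ('a \<Rightarrow> 'a \<Rightarrow> 'a) \<Rightarrow> 'a set \<Rightarrow> 'a set \<Rightarrow> 'a set" where
  "induced_lie G lie A B = (\<Union>a\<in>A. \<Union>b\<in>B. commutator_subgroup G #>\<^bsub>G\<^esub> lie a b)"

definition induced_lie_trivial :: "('a, 'm) monoid_scheme \<Rightarrow> ('a \<Rightarrow> 'a \<Rightarrow> 'a) \<Rightarrow> bool" where
  "induced_lie_trivial G lie \<longleftrightarrow>
    (\<forall>A \<in> carrier (abelianization G). \<forall>B \<in> carrier (abelianization G).
      induced_lie G lie A B = \<one>\<^bsub>abelianization G\<^esub>)"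

context multiplicative_lie_algebra
begin

lemma coset_conjugate:
  assumes "x \<in> carrier G" "y \<in> carrier G"
  shows "commutator_subgroup G #> conjugate G x y = commutator_subgroup G #> y"
proof -
  interpret N: normal "commutator_subgroup G" G by (rule derived_self_is_normal)
  have "x \<otimes> y \<otimes> inv x \<otimes> inv y \<in> commutator_subgroup G"
    unfolding derived_def using assms by (intro generate.incl) blast
  then have "conjugate G x y \<otimes> inv y \<in> commutator_subgroup G"
    using assms by (simp add: conjugate_def)
  then have "commutator_subgroup G #> (conjugate G x y \<otimes> inv y) = commutator_subgroup G"
    using N.rcos_const by (simp add: is_group)
  then have "commutator_subgroup G #> (conjugate G x y \<otimes> inv y) #> y = commutator_subgroup G #> y"
    by simp
  then show ?thesis
    using assms N.subset by (simp add: coset_mult_assoc conjugate_def m_assoc)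
qed

lemma coset_lie_hom:
  assumes "x \<in> carrier G"
  shows "(\<lambda>y. commutator_subgroup G #> (x \<star> y)) \<in> hom G (abelianization G)"
    and "(\<lambda>y. commutator_subgroup G #> (y \<star> x)) \<in> hom G (abelianization G)"
proof -
  interpret N: normal "commutator_subgroup G" G by (rule derived_self_is_normal)
  interpret Q: comm_group "abelianization G" by (rule derived_quot_is_comm_group)
  have car: "commutator_subgroup G #> y \<in> carrier (abelianization G)" if "y \<in> carrier G" for y
    using that N.subset by (auto simp: FactGroup_def RCOSETS_def)
  have cc: "conjugate G a b \<in> carrier G" if "a \<in> carrier G" "b \<in> carrier G" for a b
    using that by (simp add: conjugate_def)
  have mult: "commutator_subgroup G #> (a \<otimes> b)
      = (commutator_subgroup G #> a) \<otimes>\<^bsub>abelianization G\<^esub> (commutator_subgroup G #> b)"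
    if "a \<in> carrier G" "b \<in> carrier G" for a b
    using that N.rcos_sum by (simp add: FactGroup_def)
  show "(\<lambda>y. commutator_subgroup G #> (x \<star> y)) \<in> hom G (abelianization G)"
    by (rule homI) (use assms in \<open>simp_all add: car lie_closed lie_mult_right mult cc coset_conjugate
      del: mult_FactGroup\<close>)
  show "(\<lambda>y. commutator_subgroup G #> (y \<star> x)) \<in> hom G (abelianization G)"
    by (rule homI) (use assms in \<open>simp_all add: car lie_closed lie_mult_left mult cc coset_conjugate
      Q.m_comm del: mult_FactGroup\<close>)
qed

lemma hom_const_on_coset:
  assumes f: "f \<in> hom G (abelianization G)" and a: "a \<in> carrier G"
    and b: "b \<in> commutator_subgroup G #> a"
  shows "f b = f a"
proof -
  interpret Q: comm_group "abelianization G" by (rule derived_quot_is_comm_group)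
  interpret f: group_hom G "abelianization G" f
    by unfold_locales (rule f)
  have sub: "commutator_subgroup G \<subseteq> carrier G" by (rule derived_in_carrier) simp
  have "derived_set G (carrier G) \<subseteq> kernel G (abelianization G) f"
  proof clarify
    fix x y assume xy: "x \<in> carrier G" "y \<in> carrier G"
    have "f (x \<otimes> y \<otimes> inv x \<otimes> inv y) = f (x \<otimes> y) \<otimes>\<^bsub>abelianization G\<^esub> f (inv (y \<otimes> x))"
      using xy by (simp add: inv_mult_group m_assoc flip: f.hom_mult del: mult_FactGroup f.hom_inv)
    also have "f (y \<otimes> x) = f (x \<otimes> y)"
      using xy by (simp add: Q.m_comm del: mult_FactGroup)
    then have "f (x \<otimes> y) \<otimes>\<^bsub>abelianization G\<^esub> f (inv (y \<otimes> x)) = \<one>\<^bsub>abelianization G\<^esub>"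
      using xy by (metis f.hom_closed f.hom_inv Q.r_inv m_closed)
    finally show "x \<otimes> y \<otimes> inv x \<otimes> inv y \<in> kernel G (abelianization G) f"
      using xy by (simp add: kernel_def)
  qed
  then have ker: "commutator_subgroup G \<subseteq> kernel G (abelianization G) f"
    using generate_subgroup_incl[OF _ f.subgroup_kernel] by (simp add: derived_def[of G "carrier G"])
  obtain d where d: "d \<in> commutator_subgroup G" "b = d \<otimes> a"
    using b by (auto simp: r_coset_def)
  have "f d = \<one>\<^bsub>abelianization G\<^esub>" using ker d by (auto simp: kernel_def)
  moreover have "d \<in> carrier G" using d sub by blast
  ultimately show ?thesis
    using d a f.hom_mult[of d a] Q.l_one[of "f a"] f.hom_closed[of a] by metis
qed

lemma induced_lie_coset:
  assumes a: "a \<in> carrier G" and b: "b \<in> carrier G"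
  shows "induced_lie G (\<star>) (commutator_subgroup G #> a) (commutator_subgroup G #> b)
    = commutator_subgroup G #> (a \<star> b)"
proof -
  interpret N: normal "commutator_subgroup G" G by (rule derived_self_is_normal)
  have eq: "commutator_subgroup G #> (a' \<star> b') = commutator_subgroup G #> (a \<star> b)"
    if a': "a' \<in> commutator_subgroup G #> a" and b': "b' \<in> commutator_subgroup G #> b" for a' b'
  proof -
    have c: "a' \<in> carrier G" using a' a N.subset r_coset_subset_G by blast
    show ?thesis
      using hom_const_on_coset[OF coset_lie_hom(1)[OF c] b b']
        hom_const_on_coset[OF coset_lie_hom(2)[OF b] a a'] by simp
  qed
  moreover have "a \<in> commutator_subgroup G #> a" "b \<in> commutator_subgroup G #> b"
    using a b rcos_self N.subgroup_axioms by auto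
  ultimately show ?thesis unfolding induced_lie_def by blast
qed

lemma induced_lie_trivial_iff:
  "induced_lie_trivial G (\<star>) \<longleftrightarrow>
    (\<forall>a \<in> carrier G. \<forall>b \<in> carrier G. a \<star> b \<in> commutator_subgroup G)"
proof -
  interpret N: normal "commutator_subgroup G" G by (rule derived_self_is_normal)
  have "(commutator_subgroup G #> c = commutator_subgroup G) \<longleftrightarrow> c \<in> commutator_subgroup G"
    if "c \<in> carrier G" for c
    using that N.rcos_const rcos_self[OF that N.subgroup_axioms] is_group by blast
  then show ?thesis
    by (auto simp: induced_lie_trivial_def FactGroup_def RCOSETS_def induced_lie_coset lie_closed)
qed

end

end

theory Submission
  imports Defs
begin

text \<open>
  Since the induced structure is trivial, every product \<open>a \<star> b\<close> lies in the commutator subgroup and is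
  therefore central. Conjugation fixes central elements, so the twisted distributive laws lose
  their twist: \<open>\<star>\<close> is multiplicative in each argument (\<open>lie_hom_right\<close>, \<open>lie_hom_left\<close>). A
  homomorphism with commuting values kills commutators, hence is constant on the cosets of the
  commutator subgroup (\<open>commuting_image_const_on_coset\<close>). Applied to each argument in turn, this lets
  \<open>\<star>\<close> descend to the abelianization; the descended map is \<open>h\<close>, and its three properties are those of
  \<open>\<star>\<close> read off at representatives.
\<close>

text \<open>
  The kernel is a subgroup, so it suffices that it contains the generators: the image of a commutator
  is the commutator of the images.
\<close>

lemma (in group_hom) derived_subset_kernel:
  assumes comm: "\<And>x y. \<lbrakk>x \<in> carrier G; y \<in> carrier G\<rbrakk> \<Longrightarrow> h x \<otimes>\<^bsub>H\<^esub> h y = h y \<otimes>\<^bsub>H\<^esub> h x"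
  shows "derived G (carrier G) \<subseteq> kernel G H h"
proof -
  have "derived_set G (carrier G) \<subseteq> kernel G H h"
  proof clarify
    fix x y assume xy: "x \<in> carrier G" "y \<in> carrier G"
    have "h x \<otimes>\<^bsub>H\<^esub> h y \<otimes>\<^bsub>H\<^esub> inv\<^bsub>H\<^esub> h x = h y"
      using xy comm[OF xy] by (simp add: H.inv_solve_right')
    then have "h x \<otimes>\<^bsub>H\<^esub> h y \<otimes>\<^bsub>H\<^esub> inv\<^bsub>H\<^esub> h x \<otimes>\<^bsub>H\<^esub> inv\<^bsub>H\<^esub> h y = \<one>\<^bsub>H\<^esub>"
      using xy by simp
    then show "x \<otimes> y \<otimes> inv x \<otimes> inv y \<in> kernel G H h"
      using xy by (simp add: kernel_def)
  qed
  then show ?thesis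
    unfolding derived_def by (rule G.generate_subgroup_incl) (rule subgroup_kernel)
qed

lemma (in group_hom) commuting_image_const_on_coset:
  assumes comm: "\<And>x y. \<lbrakk>x \<in> carrier G; y \<in> carrier G\<rbrakk> \<Longrightarrow> h x \<otimes>\<^bsub>H\<^esub> h y = h y \<otimes>\<^bsub>H\<^esub> h x"
    and a: "a \<in> carrier G" and b: "b \<in> derived G (carrier G) #> a"
  shows "h b = h a"
proof -
  obtain d where d: "d \<in> derived G (carrier G)" "b = d \<otimes> a"
    using b by (auto simp: r_coset_def)
  then have "d \<in> kernel G H h"
    using derived_subset_kernel[OF comm] by blast
  then show ?thesis
    using a d by (simp add: kernel_def)
qed

locale central_multiplicative_lie_algebra = multiplicative_lie_algebra +
  assumes lie_central: "\<lbrakk>x \<in> carrier G; y \<in> carrier G\<rbrakk> \<Longrightarrow> x \<star> y \<in> group_center G"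
begin

lemma lie_commute:
  "\<lbrakk>x \<in> carrier G; y \<in> carrier G; g \<in> carrier G\<rbrakk> \<Longrightarrow> (x \<star> y) \<otimes> g = g \<otimes> (x \<star> y)"
  using lie_central by (simp add: group_center_def)

lemma conjugate_lie:
  "\<lbrakk>g \<in> carrier G; x \<in> carrier G; y \<in> carrier G\<rbrakk> \<Longrightarrow> conjugate G g (x \<star> y) = x \<star> y"
  using lie_commute[of x y g] by (simp add: conjugate_def lie_closed inv_solve_right')

lemma lie_hom_right:
  assumes "x \<in> carrier G"
  shows "group_hom G G (\<lambda>y. x \<star> y)"
  by unfold_locales
    (use assms in \<open>auto intro!: homI simp: lie_closed lie_mult_right conjugate_lie\<close>)

text \<open>
  The left distributive law yields its two factors in reversed order; centrality also restores the order.
\<close>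

lemma lie_hom_left:
  assumes "y \<in> carrier G"
  shows "group_hom G G (\<lambda>x. x \<star> y)"
proof unfold_locales
  show "(\<lambda>x. x \<star> y) \<in> hom G G"
  proof (rule homI)
    fix a b assume "a \<in> carrier G" "b \<in> carrier G"
    then show "(a \<otimes> b) \<star> y = (a \<star> y) \<otimes> (b \<star> y)"
      using assms by (simp add: lie_mult_left conjugate_lie lie_closed lie_commute[of b y "a \<star> y"])
  qed (use assms in \<open>simp add: lie_closed\<close>)
qed

text \<open>
  This is what makes \<open>\<star>\<close> descend to a map of pairs of cosets. The representatives are exchanged one
  argument at a time, since each distributive law gives a homomorphism in one argument only.
\<close>

lemma lie_const_on_cosets:
  assumes "a \<in> carrier G" "b \<in> carrier G"
    and a': "a' \<in> commutator_subgroup G #> a" and b': "b' \<in> commutator_subgroup G #> b"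
  shows "a' \<star> b' = a \<star> b"
proof -
  have "a' \<in> carrier G"
    using a' assms(1) r_coset_subset_G derived_in_carrier by blast
  then have "a' \<star> b' = a' \<star> b"
    using assms
    by (intro group_hom.commuting_image_const_on_coset[OF lie_hom_right])
      (auto intro: lie_commute lie_closed)
  also have "\<dots> = a \<star> b"
    using assms
    by (intro group_hom.commuting_image_const_on_coset[OF lie_hom_left])
      (auto intro: lie_commute lie_closed)
  finally show ?thesis .
qed

end

theorem proposition4p3:
  fixes G :: "('a, 'm) monoid_scheme" and lie :: "'a \<Rightarrow> 'a \<Rightarrow> 'a"
  assumes "nilpotent_class_two G"
    and "multiplicative_lie_algebra G lie"
    and "induced_lie_trivial G lie"
  shows "\<exists>h \<in> carrier (abelianization G) \<rightarrow> carrier (abelianization G) \<rightarrow> commutator_subgroup G.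
    (\<forall>a \<in> carrier G. \<forall>b \<in> carrier G.
      lie a b = h (commutator_subgroup G #>\<^bsub>G\<^esub> a) (commutator_subgroup G #>\<^bsub>G\<^esub> b)) \<and>
    (\<forall>x \<in> carrier (abelianization G). \<forall>y \<in> carrier (abelianization G).
      \<forall>z \<in> carrier (abelianization G).
        h x x = \<one>\<^bsub>G\<^esub> \<and>
        h (x \<otimes>\<^bsub>abelianization G\<^esub> y) z = h x z \<otimes>\<^bsub>G\<^esub> h y z \<and>
        h x (y \<otimes>\<^bsub>abelianization G\<^esub> z) = h x y \<otimes>\<^bsub>G\<^esub> h x z)"
proof -
  interpret multiplicative_lie_algebra G lie by (rule assms(2))
  have derived: "lie a b \<in> commutator_subgroup G" if "a \<in> carrier G" "b \<in> carrier G" for a b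
    using that assms(3) induced_lie_trivial_iff by blast
  interpret central_multiplicative_lie_algebra G lie
    by unfold_locales (use assms(1) derived in \<open>auto simp: nilpotent_class_two_def\<close>)
  interpret N: normal "commutator_subgroup G" G by (rule derived_self_is_normal)
  define cl where "cl a = commutator_subgroup G #>\<^bsub>G\<^esub> a" for a
  define h where "h A B = lie (SOME a. a \<in> A) (SOME b. b \<in> B)" for A B
  have h_cl: "h (cl a) (cl b) = lie a b" if "a \<in> carrier G" "b \<in> carrier G" for a b
  proof -
    have "(SOME c. c \<in> cl g) \<in> cl g" if "g \<in> carrier G" for g
      using rcos_self[OF that N.subgroup_axioms] unfolding cl_def by (rule someI)
    with that show ?thesis
      unfolding h_def by (intro lie_const_on_cosets) (simp_all add: cl_def)
  qed
  have cl_mult: "cl a \<otimes>\<^bsub>abelianization G\<^esub> cl b = cl (a \<otimes>\<^bsub>G\<^esub> b)"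
    if "a \<in> carrier G" "b \<in> carrier G" for a b
    using that N.rcos_sum by (simp add: cl_def)
  have carrier: "carrier (abelianization G) = cl ` carrier G"
    by (auto simp: FactGroup_def RCOSETS_def cl_def)
  have left: "lie (a \<otimes>\<^bsub>G\<^esub> b) c = lie a c \<otimes>\<^bsub>G\<^esub> lie b c"
    and right: "lie a (b \<otimes>\<^bsub>G\<^esub> c) = lie a b \<otimes>\<^bsub>G\<^esub> lie a c"
    if "a \<in> carrier G" "b \<in> carrier G" "c \<in> carrier G" for a b c
    using that group_hom.hom_mult[OF lie_hom_left] group_hom.hom_mult[OF lie_hom_right] by auto
  show ?thesis
  proof (intro bexI[of _ h] conjI ballI)
    show "h \<in> carrier (abelianization G) \<rightarrow> carrier (abelianization G) \<rightarrow> commutator_subgroup G"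
      by (auto simp: carrier h_cl derived)
  next
    fix a b assume "a \<in> carrier G" "b \<in> carrier G"
    then show "lie a b = h (commutator_subgroup G #>\<^bsub>G\<^esub> a) (commutator_subgroup G #>\<^bsub>G\<^esub> b)"
      using h_cl by (simp add: cl_def)
  qed (auto simp: carrier cl_mult h_cl lie_self left right simp del: mult_FactGroup)
qed

end
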